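(* For any degree $m\ge2$ and for all $p\ge m$, the integral quasi-interpolants $G_p^*$ are uniformly bounded independently of the partition $T$. More specifically, there holds $$\Vert G_p^*\Vert_\infty\le1+\frac14C(m),\qquad\text{with}\quad C(m)=\begin{cases}\dfrac{m^2(m+2)}{(m-1)^2}&\text{for } m \text{ even},\\[2mm]\dfrac{(m+1)^2}{m-1}&\text{for } m\text{ odd}.\end{cases}$$
   Context: $T=\{t_i\}_{i\in\mathbb{Z}}$ is a strictly increasing sequence of real knots with $|t_i|\to+\infty$ as $|i|\to+\infty$. $B_i$ ($i\in\mathbb{Z}$) is the B-spline of degree $m$ with support $[t_{i-m},t_{i+1}]$, normalized so that $\sum_iB_i=1$. $M_i$ is the B-spline of degree $m-2$ with knots $t_{i-m+1},\ldots,t_i$ (support $[t_{i-m+1},t_i]$), normalized by $\int_{\mathbb{R}}M_i=1$; write $\langle M_i,f\rangle=\int_{\mathbb{R}}M_i(t)f(t)\,dt$. Set $$\theta_i=\frac1m\sum_{r=1}^m t_{i+1-r},\quad \theta_i^{(2)}=\frac{2}{m(m-1)}\sum_{1\le r<s\le m}t_{i+1-r}t_{i+1-s},\quad \mu_i^{(2)}=\frac{2}{m(m+1)}\sum_{1\le r\le s\le m}t_{i+1-r}t_{i+1-s}$$ ($\theta_i$ and $\mu_i^{(2)}$ are the first and second moments of $M_i$). The operator is $G_p^*f=\sum_{i\in\mathbb{Z}}\lambda_i^*(f)B_i$ with $$\lambda_i^*(f)=a_i^*(-p)\langle M_{i-p},f\rangle+a_i^*(0)\langle M_i,f\rangle+a_i^*(p)\langle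 M_{i+p},f\rangle,$$ where $(a_i^*(-p),a_i^*(0),a_i^*(p))$ is the unique solution of $$a_i^*(-p)+a_i^*(0)+a_i^*(p)=1,$$ $$\theta_{i-p}a_i^*(-p)+\theta_ia_i^*(0)+\theta_{i+p}a_i^*(p)=\theta_i,$$ $$\mu_{i-p}^{(2)}a_i^*(-p)+\mu_i^{(2)}a_i^*(0)+\mu_{i+p}^{(2)}a_i^*(p)=\theta_i^{(2)}.$$ $\Vert G\Vert_\infty$ is the operator norm: the supremum of $\Vert Gf\Vert_\infty$ over bounded continuous $f:\mathbb{R}\to\mathbb{R}$ with $\Vert f\Vert_\infty\le1$. *)

theory Defs
  imports "HOL-Analysis.Analysis"
begin

definition knot_sequence :: "(int \<Rightarrow> real) \<Rightarrow> bool" where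
  "knot_sequence t \<longleftrightarrow>
     strict_mono t \<and>
     filterlim (\<lambda>i. \<bar>t i\<bar>) at_top at_top \<and>
     filterlim (\<lambda>i. \<bar>t i\<bar>) at_top at_bot"

(* Cox--de Boor recursion: bspline t k j is the B-spline of degree k with knots
   t j, ..., t (j + k + 1), in the normalization for which the bspline t k j, j an
   integer, sum to 1 at every real point. *)
fun bspline :: "(int \<Rightarrow> real) \<Rightarrow> nat \<Rightarrow> int \<Rightarrow> real \<Rightarrow> real" where
  "bspline t 0 j x = indicator {t j..<t (j + 1)} x"
| "bspline t (Suc k) j x =
     (x - t j) / (t (j + int k + 1) - t j) * bspline t k j x +
     (t (j + int k + 2) - x) / (t (j + int k + 2) - t (j + 1)) * bspline t k (j + 1) x"

(* Support [t (i - m), t (i + 1)]. *)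
definition bspline_B :: "(int \<Rightarrow> real) \<Rightarrow> nat \<Rightarrow> int \<Rightarrow> real \<Rightarrow> real" where
  "bspline_B t m i = bspline t m (i - int m)"

(* Degree m - 2, support [t (i - m + 1), t i], scaled to integral 1. *)
definition bspline_M :: "(int \<Rightarrow> real) \<Rightarrow> nat \<Rightarrow> int \<Rightarrow> real \<Rightarrow> real" where
  "bspline_M t m i x =
     bspline t (m - 2) (i - int m + 1) x / (LBINT y. bspline t (m - 2) (i - int m + 1) y)"

definition pairing :: "(real \<Rightarrow> real) \<Rightarrow> (real \<Rightarrow> real) \<Rightarrow> real" where
  "pairing g f = (LBINT y. g y * f y)"

definition theta :: "(int \<Rightarrow> real) \<Rightarrow> nat \<Rightarrow> int \<Rightarrow> real" where
  "theta t m i = 1 / real m * (\<Sum>r=1..m. t (i + 1 - int r))"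

definition theta2 :: "(int \<Rightarrow> real) \<Rightarrow> nat \<Rightarrow> int \<Rightarrow> real" where
  "theta2 t m i = 2 / (real m * (real m - 1)) *
     (\<Sum>s=1..m. \<Sum>r=1..<s. t (i + 1 - int r) * t (i + 1 - int s))"

definition mu2 :: "(int \<Rightarrow> real) \<Rightarrow> nat \<Rightarrow> int \<Rightarrow> real" where
  "mu2 t m i = 2 / (real m * (real m + 1)) *
     (\<Sum>s=1..m. \<Sum>r=1..s. t (i + 1 - int r) * t (i + 1 - int s))"

(* The weights of bspline_M at i - p, i, i + p, in this order. *)
definition coeffs :: "(int \<Rightarrow> real) \<Rightarrow> nat \<Rightarrow> nat \<Rightarrow> int \<Rightarrow> real \<times> real \<times> real" where
  "coeffs t m p i = (THE (a, b, c).
     a + b + c = 1 \<and>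
     theta t m (i - int p) * a + theta t m i * b + theta t m (i + int p) * c = theta t m i \<and>
     mu2 t m (i - int p) * a + mu2 t m i * b + mu2 t m (i + int p) * c = theta2 t m i)"

definition lam :: "(int \<Rightarrow> real) \<Rightarrow> nat \<Rightarrow> nat \<Rightarrow> int \<Rightarrow> (real \<Rightarrow> real) \<Rightarrow> real" where
  "lam t m p i f = (case coeffs t m p i of (a, b, c) \<Rightarrow>
     a * pairing (bspline_M t m (i - int p)) f + b * pairing (bspline_M t m i) f +
     c * pairing (bspline_M t m (i + int p)) f)"

(* At each point only finitely many bspline_B t m i are nonzero. *)
definition quasi_interp :: "(int \<Rightarrow> real) \<Rightarrow> nat \<Rightarrow> nat \<Rightarrow> (real \<Rightarrow> real) \<Rightarrow> real \<Rightarrow> real" where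
  "quasi_interp t m p f x = (\<Sum>\<^sub>\<infinity>i\<in>UNIV. lam t m p i f * bspline_B t m i x)"

(* Extended-real valued, so that unbounded functions and operators have norm infinity. *)
definition sup_norm :: "(real \<Rightarrow> real) \<Rightarrow> ereal" where
  "sup_norm f = (SUP x. ereal \<bar>f x\<bar>)"

definition op_norm :: "((real \<Rightarrow> real) \<Rightarrow> real \<Rightarrow> real) \<Rightarrow> ereal" where
  "op_norm A =
     (SUP f\<in>{f. continuous_on UNIV f \<and> bounded (range f) \<and> sup_norm f \<le> 1}. sup_norm (A f))"

definition bound_const :: "nat \<Rightarrow> real" where
  "bound_const m = (if even m then (real m)\<^sup>2 * (real m + 2) / (real m - 1)\<^sup>2
          else (real m + 1)\<^sup>2 / (real m - 1))"

end

theory Submission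
  imports Defs
begin

text \<open>
  The B-splines \<open>B\<^sub>i\<close> are nonnegative and sum to 1, and the \<open>M\<^sub>i\<close> are nonnegative with integral at
  most 1. Hence the operator norm is at most the supremum over \<open>i\<close> of \<open>\<bar>a\<bar> + \<bar>b\<bar> + \<bar>c\<bar>\<close>, where
  \<open>(a, b, c)\<close> solves the three moment equations of index \<open>i\<close>.

  Let \<open>\<theta>\<close> be the mean of the \<open>m\<close> knots of window \<open>i\<close> and \<open>w\<close> the sum of their squared deviations from
  it. Then \<open>mu2 t m i = \<theta>\<^sup>2 + w / (m (m + 1))\<close> and \<open>theta2 t m i = \<theta>\<^sup>2 - w / (m (m - 1))\<close> (lemmas
  \<open>mu2_eq\<close>, \<open>theta2_eq\<close>), so the two differ by \<open>2 w / (m\<^sup>2 - 1)\<close>. With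
  \<open>h\<close> and \<open>k\<close> the distances from \<open>\<theta>\<close> to the means of the windows \<open>i - p\<close> and \<open>i + p\<close>, elimination gives
  \<open>a, c \<le> 0 \<le> b\<close> and, after dropping the deviations of the two outer windows,
  \<open>\<bar>a\<bar> + \<bar>c\<bar> \<le> (2 w / (m\<^sup>2 - 1)) / (h k - w / (m (m + 1)))\<close>. Since \<open>p \<ge> m\<close>, the outer windows lie on
  either side of window \<open>i\<close>, so \<open>h\<close> and \<open>k\<close> exceed the distances from \<open>\<theta>\<close> to the extreme knots of
  that window, and the Bhatia--Davis inequality yields \<open>h k \<ge> w / m\<close>. Therefore
  \<open>\<bar>a\<bar> + \<bar>c\<bar> \<le> 2 / (m - 1)\<close>, and \<open>\<bar>a\<bar> + \<bar>b\<bar> + \<bar>c\<bar> = 1 + 2 (\<bar>a\<bar> + \<bar>c\<bar>) \<le> 1 + 4 / (m - 1)\<close>. This is at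
  most the claimed constant, with equality for \<open>m = 2\<close> and \<open>m = 3\<close>.
\<close>

section \<open>B-splines as a partition of unity\<close>

lemma bspline_nonneg_support:
  assumes t: "strict_mono t"
  shows "0 \<le> bspline t k j x \<and> (x < t j \<or> t (j + int k + 1) \<le> x \<longrightarrow> bspline t k j x = 0)"
proof (induction k arbitrary: j)
  case 0
  show ?case by (auto simp: indicator_def)
next
  case (Suc k)
  have lt: "t a < t b" if "a < b" for a b
    using t that by (simp add: strict_monoD)
  have A: "t j < t (j + 1)" "t j < t (j + int k + 1)" "t (j + 1) < t (j + int k + 2)"
      "t (j + int k + 1) < t (j + int k + 2)"
    by (auto intro!: lt)
  have i1: "0 \<le> bspline t k j x" "x < t j \<or> t (j + int k + 1) \<le> x \<Longrightarrow> bspline t k j x = 0"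
    using Suc.IH[of j] by auto
  have i2: "0 \<le> bspline t k (j + 1) x"
      "x < t (j + 1) \<or> t (j + int k + 2) \<le> x \<Longrightarrow> bspline t k (j + 1) x = 0"
    using Suc.IH[of "j + 1"] by (auto simp: algebra_simps)
  have "0 \<le> (x - t j) / (t (j + int k + 1) - t j) * bspline t k j x"
    using A i1 by (cases "x < t j") (auto intro!: mult_nonneg_nonneg divide_nonneg_nonneg)
  moreover have "0 \<le> (t (j + int k + 2) - x) / (t (j + int k + 2) - t (j + 1)) * bspline t k (j + 1) x"
    using A i2
    by (cases "t (j + int k + 2) \<le> x") (auto intro!: mult_nonneg_nonneg divide_nonneg_nonneg)
  moreover have "bspline t (Suc k) j x = 0" if "x < t j \<or> t (j + int (Suc k) + 1) \<le> x"
  proof -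
    have "x < t j \<or> t (j + int k + 2) \<le> x"
      using that by (simp add: algebra_simps)
    then have "bspline t k j x = 0" "bspline t k (j + 1) x = 0"
      using A i1(2) i2(2) by auto
    then show ?thesis by simp
  qed
  ultimately show ?case by simp
qed

lemma bspline_nonneg: "strict_mono t \<Longrightarrow> 0 \<le> bspline t k j x"
  using bspline_nonneg_support by blast

lemma bspline_eq_0:
  "strict_mono t \<Longrightarrow> x < t j \<or> t (j + int k + 1) \<le> x \<Longrightarrow> bspline t k j x = 0"
  using bspline_nonneg_support by blast

lemma sum_bspline_eq_1:
  assumes t: "strict_mono t" and x: "t n \<le> x" "x < t (n + 1)"
  shows "(\<Sum>j\<in>{n - int k..n}. bspline t k j x) = 1"
proof (induction k)
  case 0
  show ?case using x by simp
next
  case (Suc k)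
  define \<omega> where "\<omega> j = (x - t j) / (t (j + int k + 1) - t j)" for j
  define b where "b j = bspline t k j x" for j
  have step: "bspline t (Suc k) j x = \<omega> j * b j + (1 - \<omega> (j + 1)) * b (j + 1)" for j
  proof -
    have "t (j + 1) < t (j + int k + 2)"
      by (rule strict_monoD[OF t]) simp
    then have "(t (j + int k + 2) - x) / (t (j + int k + 2) - t (j + 1)) = 1 - \<omega> (j + 1)"
      by (simp add: \<omega>_def field_simps)
    then show ?thesis by (simp add: \<omega>_def b_def)
  qed
  have b_left: "b (n - int k - 1) = 0"
    unfolding b_def by (rule bspline_eq_0[OF t]) (use x in simp)
  have b_right: "b (n + 1) = 0"
    unfolding b_def by (rule bspline_eq_0[OF t]) (use x in simp)
  have set_left: "{n - int (Suc k)..n} = insert (n - int k - 1) {n - int k..n}" by auto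
  have set_right: "{n - int k..n + 1} = insert (n + 1) {n - int k..n}" by auto
  have "(\<Sum>j\<in>{n - int (Suc k)..n}. bspline t (Suc k) j x)
      = (\<Sum>j\<in>{n - int (Suc k)..n}. \<omega> j * b j)
        + (\<Sum>j\<in>{n - int (Suc k)..n}. (1 - \<omega> (j + 1)) * b (j + 1))"
    unfolding step by (rule sum.distrib)
  also have "(\<Sum>j\<in>{n - int (Suc k)..n}. (1 - \<omega> (j + 1)) * b (j + 1))
      = (\<Sum>j\<in>{n - int k..n + 1}. (1 - \<omega> j) * b j)"
    by (rule sum.reindex_bij_witness[where i="\<lambda>j. j - 1" and j="\<lambda>j. j + 1"]) auto
  also have "\<dots> = (\<Sum>j\<in>{n - int k..n}. (1 - \<omega> j) * b j)"
    unfolding set_right using b_right by simp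
  also have "(\<Sum>j\<in>{n - int (Suc k)..n}. \<omega> j * b j) = (\<Sum>j\<in>{n - int k..n}. \<omega> j * b j)"
    unfolding set_left using b_left by simp
  also have "\<dots> + (\<Sum>j\<in>{n - int k..n}. (1 - \<omega> j) * b j) = (\<Sum>j\<in>{n - int k..n}. b j)"
    by (simp add: sum.distrib[symmetric] algebra_simps)
  also have "\<dots> = 1"
    using Suc.IH by (simp add: b_def)
  finally show ?case .
qed

lemma knot_interval_exists:
  assumes "knot_sequence t"
  obtains n where "t n \<le> x" "x < t (n + 1)"
proof -
  have t: "strict_mono t"
    and top: "filterlim (\<lambda>i. \<bar>t i\<bar>) at_top at_top"
    and bot: "filterlim (\<lambda>i. \<bar>t i\<bar>) at_top at_bot"
    using assms by (auto simp: knot_sequence_def)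
  have mono: "t a \<le> t b" if "a \<le> b" for a b
    using t that by (simp add: strict_mono_less_eq)
  have "eventually (\<lambda>i. \<bar>x\<bar> + \<bar>t 0\<bar> < \<bar>t i\<bar> \<and> 0 \<le> i) at_top"
    using top eventually_ge_at_top[of 0]
    by (intro eventually_conj) (auto simp: filterlim_at_top_dense)
  then obtain N where N: "\<bar>x\<bar> + \<bar>t 0\<bar> < \<bar>t N\<bar>" "0 \<le> N"
    using eventually_happens'[OF trivial_limit_at_top_linorder] by blast
  have "eventually (\<lambda>i. \<bar>x\<bar> + \<bar>t 0\<bar> < \<bar>t i\<bar> \<and> i \<le> 0) at_bot"
    using bot eventually_le_at_bot[of 0]
    by (intro eventually_conj) (auto simp: filterlim_at_top_dense)
  then obtain M where M: "\<bar>x\<bar> + \<bar>t 0\<bar> < \<bar>t M\<bar>" "M \<le> 0"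
    using eventually_happens'[OF trivial_limit_at_bot_linorder] by blast
  have xN: "x < t N" and xM: "t M \<le> x"
    using N M mono[of 0 N] mono[of M 0] by linarith+
  define S where "S = {j \<in> {M..N}. t j \<le> x}"
  have fin: "finite S" by (rule finite_subset[of _ "{M..N}"]) (auto simp: S_def)
  have "M \<in> S" using xM M N by (simp add: S_def)
  then have "Max S \<in> S" using fin Max_in by blast
  then have 1: "t (Max S) \<le> x" "M \<le> Max S" "Max S \<le> N"
    by (auto simp: S_def)
  moreover have "x < t (Max S + 1)"
  proof (rule ccontr)
    assume "\<not> x < t (Max S + 1)"
    moreover have "Max S \<noteq> N" using 1 xN by auto
    ultimately have "Max S + 1 \<in> S" using 1 by (simp add: S_def)
    then show False using Max_ge[OF fin] by fastforce
  qed
  ultimately show ?thesis using that by blast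
qed

lemma infsum_bspline_B_bound:
  assumes T: "knot_sequence t" and l: "\<And>i. \<bar>l i\<bar> \<le> K"
  shows "\<bar>\<Sum>\<^sub>\<infinity>i\<in>UNIV. l i * bspline_B t m i x\<bar> \<le> K"
proof -
  have t: "strict_mono t" using T by (simp add: knot_sequence_def)
  obtain n where n: "t n \<le> x" "x < t (n + 1)"
    using knot_interval_exists[OF T] by blast
  have mono: "t a \<le> t b" if "a \<le> b" for a b
    using t that by (simp add: strict_mono_less_eq)
  let ?I = "{n..n + int m}"
  have zero: "bspline_B t m i x = 0" if "i \<notin> ?I" for i
    unfolding bspline_B_def
  proof (rule bspline_eq_0[OF t])
    have "i + 1 \<le> n \<or> n + 1 \<le> i - int m" using that by auto
    then show "x < t (i - int m) \<or> t (i - int m + int m + 1) \<le> x"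
      using n mono[of "i + 1" n] mono[of "n + 1" "i - int m"] by auto
  qed
  have nonneg: "0 \<le> bspline_B t m i x" for i
    by (simp add: bspline_B_def bspline_nonneg[OF t])
  have "(\<Sum>i\<in>?I. bspline_B t m i x) = (\<Sum>j\<in>{n - int m..n}. bspline t m j x)"
    unfolding bspline_B_def
    by (rule sum.reindex_bij_witness[where i="\<lambda>j. j + int m" and j="\<lambda>i. i - int m"]) auto
  then have one: "(\<Sum>i\<in>?I. bspline_B t m i x) = 1"
    using sum_bspline_eq_1[OF t n] by simp
  have "(\<Sum>\<^sub>\<infinity>i\<in>UNIV. l i * bspline_B t m i x) = (\<Sum>\<^sub>\<infinity>i\<in>?I. l i * bspline_B t m i x)"
    by (rule infsum_cong_neutral) (use zero in auto)
  also have "\<dots> = (\<Sum>i\<in>?I. l i * bspline_B t m i x)"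
    by simp
  also have "\<bar>\<dots>\<bar> \<le> (\<Sum>i\<in>?I. \<bar>l i * bspline_B t m i x\<bar>)"
    by (rule sum_abs)
  also have "\<dots> \<le> (\<Sum>i\<in>?I. K * bspline_B t m i x)"
    using l nonneg by (intro sum_mono) (simp add: abs_mult mult_right_mono)
  also have "\<dots> = K"
    using one by (simp add: sum_distrib_left[symmetric])
  finally show ?thesis .
qed

section \<open>Averages against normalized B-splines\<close>

text \<open>Where \<open>g\<close> or \<open>g f\<close> fails to be integrable, the integral in question is 0 by convention, and so is
  a quotient with denominator 0; the bound therefore needs no integrability assumption.\<close>

lemma abs_pairing_normalized_le_1:
  assumes g: "\<And>y. 0 \<le> g y" and f: "\<And>y. \<bar>f y\<bar> \<le> 1"
  shows "\<bar>pairing (\<lambda>x. g x / (LBINT y. g y)) f\<bar> \<le> 1"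
proof -
  let ?I = "LBINT y. g y"
  have I: "0 \<le> ?I"
    using g by (simp add: set_lebesgue_integral_def integral_nonneg_AE)
  have eq: "pairing (\<lambda>x. g x / ?I) f = (LBINT y. g y * f y) / ?I"
    by (simp add: pairing_def set_lebesgue_integral_def)
  show ?thesis
  proof (cases "?I = 0")
    case True
    then show ?thesis unfolding eq by simp
  next
    case False
    then have intg: "integrable lborel g"
      using not_integrable_integral_eq by (force simp: set_lebesgue_integral_def)
    have "\<bar>LBINT y. g y * f y\<bar> \<le> ?I"
    proof (cases "integrable lborel (\<lambda>y. g y * f y)")
      case True
      have "\<bar>LBINT y. g y * f y\<bar> \<le> (\<integral>y. \<bar>g y * f y\<bar> \<partial>lborel)"
        by (simp add: set_lebesgue_integral_def)
      also have "\<dots> \<le> (\<integral>y. g y \<partial>lborel)"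
        using integrable_abs[OF True] intg g f
        by (intro integral_mono) (auto simp: abs_mult mult_left_le)
      finally show ?thesis by (simp add: set_lebesgue_integral_def)
    next
      case False
      then show ?thesis
        using I by (simp add: set_lebesgue_integral_def not_integrable_integral_eq)
    qed
    then show ?thesis
      unfolding eq using I False by (simp add: abs_divide divide_le_eq)
  qed
qed

section \<open>Moments of a window of knots\<close>

lemma double_sums:
  fixes u :: "nat \<Rightarrow> real"
  shows "2 * (\<Sum>s=1..m. \<Sum>r=1..<s. u r * u s) = (\<Sum>r=1..m. u r)\<^sup>2 - (\<Sum>r=1..m. (u r)\<^sup>2)"
    and "2 * (\<Sum>s=1..m. \<Sum>r=1..s. u r * u s) = (\<Sum>r=1..m. u r)\<^sup>2 + (\<Sum>r=1..m. (u r)\<^sup>2)"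
proof -
  show *: "2 * (\<Sum>s=1..m. \<Sum>r=1..<s. u r * u s) = (\<Sum>r=1..m. u r)\<^sup>2 - (\<Sum>r=1..m. (u r)\<^sup>2)" for m
  proof (induction m)
    case (Suc m)
    have "(\<Sum>r=1..<Suc m. u r * u (Suc m)) = (\<Sum>r=1..m. u r) * u (Suc m)"
      by (simp add: sum_distrib_right atLeastLessThanSuc_atLeastAtMost)
    then show ?case
      using Suc.IH by (simp add: power2_eq_square algebra_simps)
  qed simp
  have "(\<Sum>r=1..s. u r * u s) = (\<Sum>r=1..<s. u r * u s) + (u s)\<^sup>2" if "s \<in> {1..m}" for s
    using that by (cases s) (auto simp: atLeastLessThanSuc_atLeastAtMost power2_eq_square)
  then have "(\<Sum>s=1..m. \<Sum>r=1..s. u r * u s)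
      = (\<Sum>s=1..m. \<Sum>r=1..<s. u r * u s) + (\<Sum>s=1..m. (u s)\<^sup>2)"
    by (simp add: sum.distrib)
  then show "2 * (\<Sum>s=1..m. \<Sum>r=1..s. u r * u s) = (\<Sum>r=1..m. u r)\<^sup>2 + (\<Sum>r=1..m. (u r)\<^sup>2)"
    using *[of m] by simp
qed

text \<open>The sum of the squared deviations of the knots \<open>t\<^bsub>i-m+1\<^esub>, \<dots>, t\<^sub>i\<close> from their mean.\<close>

definition sq_dev :: "(int \<Rightarrow> real) \<Rightarrow> nat \<Rightarrow> int \<Rightarrow> real" where
  "sq_dev t m i = (\<Sum>r=1..m. (t (i + 1 - int r) - theta t m i)\<^sup>2)"

lemma sum_knots_eq: "m > 0 \<Longrightarrow> (\<Sum>r=1..m. t (i + 1 - int r)) = real m * theta t m i"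
  by (simp add: theta_def)

lemma sum_knots_sq_eq:
  assumes "m > 0"
  shows "(\<Sum>r=1..m. (t (i + 1 - int r))\<^sup>2) = sq_dev t m i + real m * (theta t m i)\<^sup>2"
proof -
  define \<theta> where "\<theta> = theta t m i"
  have "sq_dev t m i = (\<Sum>r=1..m. (t (i + 1 - int r))\<^sup>2 - 2 * \<theta> * t (i + 1 - int r) + \<theta>\<^sup>2)"
    unfolding sq_dev_def \<theta>_def by (intro sum.cong) (auto simp: power2_eq_square algebra_simps)
  also have "\<dots> = (\<Sum>r=1..m. (t (i + 1 - int r))\<^sup>2) - 2 * \<theta> * (real m * \<theta>) + real m * \<theta>\<^sup>2"
    using sum_knots_eq[OF assms, of t i]
    by (simp add: sum.distrib sum_subtractf sum_distrib_left[symmetric] \<theta>_def)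
  finally show ?thesis by (simp add: \<theta>_def power2_eq_square)
qed

lemma theta2_eq:
  assumes "m \<ge> 2"
  shows "theta2 t m i = (theta t m i)\<^sup>2 - sq_dev t m i / (real m * (real m - 1))"
proof -
  have m: "real m - 1 > 0" "real m > 0" "m > 0" using assms by auto
  have "theta2 t m i = ((real m * theta t m i)\<^sup>2 - (sq_dev t m i + real m * (theta t m i)\<^sup>2))
      / (real m * (real m - 1))"
    using double_sums(1)[of "\<lambda>r. t (i + 1 - int r)" m]
    unfolding theta2_def sum_knots_eq[OF m(3)] sum_knots_sq_eq[OF m(3)] by (simp add: mult.commute)
  also have "(real m * theta t m i)\<^sup>2 - (sq_dev t m i + real m * (theta t m i)\<^sup>2)
      = (real m * (real m - 1)) * (theta t m i)\<^sup>2 - sq_dev t m i"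
    by (simp add: power2_eq_square algebra_simps)
  finally show ?thesis using m by (simp add: diff_divide_distrib)
qed

lemma mu2_eq:
  assumes "m > 0"
  shows "mu2 t m i = (theta t m i)\<^sup>2 + sq_dev t m i / (real m * (real m + 1))"
proof -
  have m: "real m > 0" "real m + 1 > 0" using assms by auto
  have "mu2 t m i = ((real m * theta t m i)\<^sup>2 + (sq_dev t m i + real m * (theta t m i)\<^sup>2))
      / (real m * (real m + 1))"
    using double_sums(2)[of "\<lambda>r. t (i + 1 - int r)" m]
    unfolding mu2_def sum_knots_eq[OF assms] sum_knots_sq_eq[OF assms] by (simp add: mult.commute)
  also have "(real m * theta t m i)\<^sup>2 + (sq_dev t m i + real m * (theta t m i)\<^sup>2)
      = (real m * (real m + 1)) * (theta t m i)\<^sup>2 + sq_dev t m i"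
    by (simp add: power2_eq_square algebra_simps)
  finally show ?thesis using m by (simp add: add_divide_distrib)
qed

lemma sq_dev_nonneg: "0 \<le> sq_dev t m i"
  by (simp add: sq_dev_def sum_nonneg)

lemma sq_dev_pos:
  assumes "m \<ge> 2" "strict_mono t"
  shows "0 < sq_dev t m i"
proof (rule ccontr)
  assume "\<not> 0 < sq_dev t m i"
  then have "sq_dev t m i = 0" using sq_dev_nonneg[of t m i] by simp
  then have "\<forall>r\<in>{1..m}. t (i + 1 - int r) = theta t m i"
    by (simp add: sq_dev_def sum_nonneg_eq_0_iff)
  then have "t (i + 1 - int 1) = t (i + 1 - int 2)"
    using assms(1) by (metis atLeastAtMost_iff le_refl one_le_numeral order_trans)
  moreover have "t (i + 1 - int 2) < t (i + 1 - int 1)"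
    by (rule strict_monoD[OF assms(2)]) simp
  ultimately show False by simp
qed

lemma theta_bounds:
  assumes "m > 0" "strict_mono t"
  shows "t (i + 1 - int m) \<le> theta t m i" "theta t m i \<le> t i"
proof -
  have mono: "t a \<le> t b" if "a \<le> b" for a b
    using assms(2) that by (simp add: strict_mono_less_eq)
  have "(\<Sum>r=1..m. t (i + 1 - int m)) \<le> (\<Sum>r=1..m. t (i + 1 - int r))"
    by (intro sum_mono mono) auto
  then show "t (i + 1 - int m) \<le> theta t m i"
    using assms(1) unfolding sum_knots_eq[OF assms(1)] by simp
  have "(\<Sum>r=1..m. t (i + 1 - int r)) \<le> (\<Sum>r=1..m. t i)"
    by (intro sum_mono mono) auto
  then show "theta t m i \<le> t i"
    using assms(1) unfolding sum_knots_eq[OF assms(1)] by simp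
qed

text \<open>The Bhatia--Davis inequality: numbers in \<open>[\<alpha>, \<beta>]\<close> with mean \<open>\<theta>\<close> have variance at most
  \<open>(\<beta> - \<theta>) (\<theta> - \<alpha>)\<close>.\<close>

lemma sq_dev_le:
  assumes "m > 0" "strict_mono t"
  shows "sq_dev t m i \<le> real m * ((t i - theta t m i) * (theta t m i - t (i + 1 - int m)))"
proof -
  define \<theta> \<alpha> \<beta> where "\<theta> = theta t m i" and "\<alpha> = t (i + 1 - int m)" and "\<beta> = t i"
  have mono: "t a \<le> t b" if "a \<le> b" for a b
    using assms(2) that by (simp add: strict_mono_less_eq)
  have "0 \<le> (\<Sum>r=1..m. (\<beta> - t (i + 1 - int r)) * (t (i + 1 - int r) - \<alpha>))"
    unfolding \<alpha>_def \<beta>_def by (intro sum_nonneg mult_nonneg_nonneg) (auto intro!: mono)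
  also have "\<dots> = (\<Sum>r=1..m. (\<beta> + \<alpha>) * t (i + 1 - int r) - (t (i + 1 - int r))\<^sup>2 - \<alpha> * \<beta>)"
    by (intro sum.cong) (auto simp: power2_eq_square algebra_simps)
  also have "\<dots> = (\<beta> + \<alpha>) * (real m * \<theta>) - (sq_dev t m i + real m * \<theta>\<^sup>2) - real m * (\<alpha> * \<beta>)"
    using sum_knots_eq[OF assms(1), of t i] sum_knots_sq_eq[OF assms(1), of t i]
    by (simp add: sum_subtractf sum_distrib_left[symmetric] \<theta>_def)
  finally show ?thesis
    unfolding \<theta>_def[symmetric] \<alpha>_def[symmetric] \<beta>_def[symmetric]
    by (simp add: power2_eq_square algebra_simps)
qed

section \<open>The weights of the quasi-interpolant\<close>

text \<open>The hypothesis \<open>D > 0\<close> is strict convexity of the data \<open>y\<^sub>0, y\<^sub>1, y\<^sub>2\<close> over the nodes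
  \<open>x\<^sub>1 - h, x\<^sub>1, x\<^sub>1 + k\<close>; the determinant of the system is \<open>h k D\<close>.\<close>

lemma three_point_system:
  fixes x1 h k D y0 y1 y2 z a b c :: real
  assumes "h > 0" "k > 0" and D: "D = (y2 - y1) / k - (y1 - y0) / h" "D > 0"
  defines "A \<equiv> (z - y1) / (h * D)" and "C \<equiv> (z - y1) / (k * D)"
  shows "a + b + c = 1 \<and> (x1 - h) * a + x1 * b + (x1 + k) * c = x1 \<and> y0 * a + y1 * b + y2 * c = z
     \<longleftrightarrow> a = A \<and> b = 1 - A - C \<and> c = C"
proof -
  have hkD: "h * k * D = h * (y2 - y1) - k * (y1 - y0)"
    using assms by (simp add: field_simps)
  have ne: "h \<noteq> 0" "k \<noteq> 0" "D \<noteq> 0" using assms by auto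
  show ?thesis
  proof
    assume *: "a + b + c = 1 \<and> (x1 - h) * a + x1 * b + (x1 + k) * c = x1 \<and> y0 * a + y1 * b + y2 * c = z"
    then have b: "b = 1 - a - c" by linarith
    have e1: "h * a = k * c" and e2: "(y0 - y1) * a + (y2 - y1) * c = z - y1"
      using * unfolding b by (simp_all add: algebra_simps)
    have "k * (h * D * a) = (h * k * D) * a" by simp
    also have "\<dots> = (y2 - y1) * (h * a) + k * ((y0 - y1) * a)"
      unfolding hkD by (simp add: algebra_simps)
    also have "\<dots> = k * ((y0 - y1) * a + (y2 - y1) * c)"
      unfolding e1 by (simp add: algebra_simps)
    finally have "h * D * a = z - y1" using e2 ne by simp
    moreover from this have "k * D * c = z - y1" using e1 by (simp add: mult.assoc mult.left_commute)
    ultimately have "a = A" "c = C" using ne by (simp_all add: A_def C_def field_simps)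
    then show "a = A \<and> b = 1 - A - C \<and> c = C" using b by simp
  next
    assume "a = A \<and> b = 1 - A - C \<and> c = C"
    then have abc: "a = A" "b = 1 - A - C" "c = C" by auto
    have e1: "h * A = k * C" using ne by (simp add: A_def C_def)
    have "k * ((y0 - y1) * A + (y2 - y1) * C) = (y2 - y1) * (k * C) + k * ((y0 - y1) * A)"
      by (simp add: algebra_simps)
    also have "\<dots> = (h * k * D) * A"
      unfolding e1[symmetric] hkD by (simp add: algebra_simps)
    also have "\<dots> = k * (z - y1)" using ne by (simp add: A_def)
    finally have e2: "(y0 - y1) * A + (y2 - y1) * C = z - y1" using ne by simp
    show "a + b + c = 1 \<and> (x1 - h) * a + x1 * b + (x1 + k) * c = x1 \<and> y0 * a + y1 * b + y2 * c = z"
      unfolding abc using e1 e2 by (simp add: algebra_simps)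
  qed
qed

lemma coeffs_abs_sum_le:
  assumes m: "m \<ge> 2" and p: "p \<ge> m" and t: "strict_mono t" and abc: "coeffs t m p i = (a, b, c)"
  shows "\<bar>a\<bar> + \<bar>b\<bar> + \<bar>c\<bar> \<le> 1 + 4 / (real m - 1)"
proof -
  have m0: "m > 0" and rm: "real m > 0" "real m - 1 > 0" "real m + 1 > 0" using m by auto
  define \<theta> h k where "\<theta> = theta t m i" and "h = \<theta> - theta t m (i - int p)"
    and "k = theta t m (i + int p) - \<theta>"
  define w w0 w2 where "w = sq_dev t m i" and "w0 = sq_dev t m (i - int p)"
    and "w2 = sq_dev t m (i + int p)"
  define q where "q = real m * (real m + 1)"
  have q: "q > 0" using rm by (simp add: q_def)
  have w: "w > 0" "w0 \<ge> 0" "w2 \<ge> 0"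
    using sq_dev_pos[OF m t] sq_dev_nonneg by (auto simp: w_def w0_def w2_def)
  have "theta t m (i - int p) \<le> t (i - int p)" by (rule theta_bounds[OF m0 t])
  also have "\<dots> < t (i + 1 - int m)" using p by (intro strict_monoD[OF t]) simp
  finally have h: "\<theta> - t (i + 1 - int m) < h" by (simp add: h_def)
  have "t i < t (i + int p + 1 - int m)" using p by (intro strict_monoD[OF t]) simp
  also have "\<dots> \<le> theta t m (i + int p)" by (rule theta_bounds[OF m0 t])
  finally have k: "t i - \<theta> < k" by (simp add: k_def)
  have bnd: "0 \<le> \<theta> - t (i + 1 - int m)" "0 \<le> t i - \<theta>"
    using theta_bounds[OF m0 t, of i] by (simp_all add: \<theta>_def)
  have hk0: "h > 0" "k > 0" using h k bnd by linarith+
  have "w \<le> real m * ((t i - \<theta>) * (\<theta> - t (i + 1 - int m)))"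
    unfolding w_def \<theta>_def by (rule sq_dev_le[OF m0 t])
  also have "\<dots> \<le> real m * (k * h)"
    using h k bnd hk0 by (intro mult_left_mono mult_mono) auto
  finally have hk: "w / real m \<le> h * k" using rm by (simp add: field_simps)
  define v where "v = w / real m - w / q"
  have v: "v = w / (real m + 1)" 
    unfolding v_def q_def using rm by (simp add: divide_simps) (simp add: algebra_simps)
  have vpos: "v > 0" using w rm by (simp add: v)
  define y0 y1 y2 where "y0 = mu2 t m (i - int p)" and "y1 = mu2 t m i" and "y2 = mu2 t m (i + int p)"
  define D where "D = (y2 - y1) / k - (y1 - y0) / h"
  have y: "y0 = (\<theta> - h)\<^sup>2 + w0 / q" "y1 = \<theta>\<^sup>2 + w / q" "y2 = (\<theta> + k)\<^sup>2 + w2 / q"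
    unfolding y0_def y1_def y2_def mu2_eq[OF m0]
    by (simp_all add: w_def w0_def w2_def q_def h_def k_def \<theta>_def)
  have "h * k * D = h * (y2 - y1) - k * (y1 - y0)"
    using hk0 by (simp add: D_def field_simps)
  also have "\<dots> = (h + k) * (h * k - w / q) + h * (w2 / q) + k * (w0 / q)"
    unfolding y by (simp add: power2_eq_square algebra_simps add_divide_distrib)
  \<comment> \<open>The deviations of the two outer windows only increase the determinant.\<close>
  finally have "(h + k) * (h * k - w / q) \<le> h * k * D"
    using hk0 w q by simp
  moreover have "(h + k) * v \<le> (h + k) * (h * k - w / q)"
    using hk hk0 by (intro mult_left_mono) (simp_all add: v_def)
  ultimately have hkD: "(h + k) * v \<le> h * k * D" by linarith
  have "0 < (h + k) * v" using hk0 vpos by simp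
  then have D0: "D > 0" using hkD hk0
    by (metis less_le_trans mult_pos_pos zero_less_mult_pos)
  define z where "z = theta2 t m i"
  define A C where "A = (z - y1) / (h * D)" and "C = (z - y1) / (k * D)"
  have zy: "y1 - z = 2 * w / ((real m - 1) * (real m + 1))"
  proof -
    have "y1 - z = w / q + w / (real m * (real m - 1))"
      unfolding y z_def theta2_eq[OF m] by (simp add: w_def \<theta>_def)
    also have "\<dots> = 2 * w / ((real m - 1) * (real m + 1))"
      unfolding q_def using rm by (simp add: divide_simps) (simp add: algebra_simps)
    finally show ?thesis .
  qed
  have zpos: "y1 - z > 0" unfolding zy using w rm by simp
  have sys: "a' + b' + c' = 1 \<and>
      theta t m (i - int p) * a' + theta t m i * b' + theta t m (i + int p) * c' = theta t m i \<and>
      mu2 t m (i - int p) * a' + mu2 t m i * b' + mu2 t m (i + int p) * c' = theta2 t m i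
      \<longleftrightarrow> a' = A \<and> b' = 1 - A - C \<and> c' = C" for a' b' c'
  proof -
    have "theta t m (i - int p) = \<theta> - h" "theta t m (i + int p) = \<theta> + k"
      by (simp_all add: h_def k_def)
    then show ?thesis
      using three_point_system[OF hk0 D_def D0, of a' b' c' \<theta> z]
      by (simp only: A_def C_def y0_def y1_def y2_def z_def \<theta>_def)
  qed
  have "coeffs t m p i = (A, 1 - A - C, C)"
    unfolding coeffs_def sys by (rule the_equality) auto
  then have abc': "a = A" "b = 1 - A - C" "c = C" using abc by auto
  have neg: "A \<le> 0" "C \<le> 0"
    unfolding A_def C_def using zpos hk0 D0 by (auto intro!: divide_nonpos_pos)
  have "- A - C = (y1 - z) * ((h + k) / (h * k * D))"
    unfolding A_def C_def using hk0 D0 by (simp add: divide_simps) (simp add: algebra_simps)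
  also have "\<dots> \<le> (y1 - z) * (1 / v)"
  proof (rule mult_left_mono)
    have "0 < h * k * D" using hk0 D0 by simp
    then show "(h + k) / (h * k * D) \<le> 1 / v"
      using hkD vpos by (simp add: divide_simps)
  qed (use zpos in simp)
  also have "\<dots> = 2 / (real m - 1)"
    unfolding zy v using w rm by (simp add: divide_simps)
  finally have "- A - C \<le> 2 / (real m - 1)" .
  moreover have "\<bar>a\<bar> + \<bar>b\<bar> + \<bar>c\<bar> = 1 + 2 * (- A - C)"
    unfolding abc' using neg by simp
  ultimately show ?thesis by simp
qed

section \<open>The norm of the quasi-interpolant\<close>

lemma lam_bound:
  assumes m: "m \<ge> 2" and p: "p \<ge> m" and t: "strict_mono t" and f: "\<And>y. \<bar>f y\<bar> \<le> 1"
  shows "\<bar>lam t m p i f\<bar> \<le> 1 + 4 / (real m - 1)"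
proof -
  obtain a b c where abc: "coeffs t m p i = (a, b, c)" by (cases "coeffs t m p i") auto
  let ?P = "\<lambda>j. pairing (bspline_M t m j) f"
  have P: "\<bar>?P j\<bar> \<le> 1" for j
    using abs_pairing_normalized_le_1[of "bspline t (m - 2) (j - int m + 1)" f, OF bspline_nonneg[OF t] f]
    by (simp add: bspline_M_def[abs_def])
  have le: "\<bar>s * ?P j\<bar> \<le> \<bar>s\<bar>" for s j
    using P[of j] by (simp add: abs_mult mult_left_le)
  have "lam t m p i f = a * ?P (i - int p) + b * ?P i + c * ?P (i + int p)"
    by (simp add: lam_def abc)
  then have "\<bar>lam t m p i f\<bar> \<le> \<bar>a\<bar> + \<bar>b\<bar> + \<bar>c\<bar>"
    using le[of a "i - int p"] le[of b i] le[of c "i + int p"] by linarith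
  also have "\<dots> \<le> 1 + 4 / (real m - 1)"
    by (rule coeffs_abs_sum_le[OF m p t abc])
  finally show ?thesis .
qed

lemma op_norm_quasi_interp_le:
  assumes m: "m \<ge> 2" and p: "p \<ge> m" and T: "knot_sequence t"
  shows "op_norm (quasi_interp t m p) \<le> ereal (1 + 4 / (real m - 1))"
  unfolding op_norm_def
proof (rule SUP_least)
  fix f :: "real \<Rightarrow> real"
  assume "f \<in> {f. continuous_on UNIV f \<and> bounded (range f) \<and> sup_norm f \<le> 1}"
  then have "(SUP x. ereal \<bar>f x\<bar>) \<le> 1" by (simp add: sup_norm_def)
  then have f: "\<bar>f y\<bar> \<le> 1" for y by (simp add: SUP_le_iff)
  have t: "strict_mono t" using T by (simp add: knot_sequence_def)
  have "\<bar>quasi_interp t m p f x\<bar> \<le> 1 + 4 / (real m - 1)" for x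
    unfolding quasi_interp_def by (intro infsum_bspline_B_bound T lam_bound m p t f)
  then show "sup_norm (quasi_interp t m p f) \<le> ereal (1 + 4 / (real m - 1))"
    unfolding sup_norm_def by (intro SUP_least) simp
qed

lemma four_div_le_bound_const:
  assumes m: "m \<ge> 2"
  shows "4 / (real m - 1) \<le> 1 / 4 * bound_const m"
proof (cases "even m")
  case True
  define x where "x = real m - 1"
  have x: "x \<ge> 1" using m by (simp add: x_def)
  \<comment> \<open>\<open>(x + 1)\<^sup>2 (x + 3) - 16 x\<close> factors as below; it vanishes at \<open>x = 1\<close>, that is \<open>m = 2\<close>.\<close>
  have "0 \<le> (x - 1) * (x\<^sup>2 + 6 * x - 3)"
    using x by (intro mult_nonneg_nonneg) (use zero_le_power2[of x] in linarith)+
  then have "16 * x \<le> (x + 1)\<^sup>2 * (x + 3)"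
    by (simp add: power2_eq_square algebra_simps)
  then have "4 / x \<le> 1 / 4 * ((x + 1)\<^sup>2 * (x + 3) / x\<^sup>2)"
    using x by (simp add: divide_simps power2_eq_square)
  then show ?thesis using True by (simp add: bound_const_def x_def add.commute)
next
  case False
  then have "m \<ge> 3" using m by (cases "m = 2") auto
  then have "4\<^sup>2 \<le> (real m + 1)\<^sup>2" by (intro power_mono) auto
  then have "4\<^sup>2 / (real m - 1) \<le> bound_const m"
    using m False unfolding bound_const_def by (auto intro!: divide_right_mono)
  moreover have "4 / (real m - 1) = 1 / 4 * (4\<^sup>2 / (real m - 1))" by simp
  ultimately show ?thesis by linarith
qed

theorem theorem8:
  fixes m :: nat
  assumes "m \<ge> 2"
  shows "(\<exists>K::real. \<forall>p\<ge>m. \<forall>t. knot_sequence t \<longrightarrow> op_norm (quasi_interp t m p) \<le> ereal K) \<and>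
         (\<forall>p\<ge>m. \<forall>t. knot_sequence t \<longrightarrow> op_norm (quasi_interp t m p) \<le> ereal (1 + 1 / 4 * bound_const m))"
proof -
  have "op_norm (quasi_interp t m p) \<le> ereal (1 + 1 / 4 * bound_const m)"
    if "p \<ge> m" "knot_sequence t" for p t
    using op_norm_quasi_interp_le[OF assms that] four_div_le_bound_const[OF assms]
    by (meson add_left_mono ereal_less_eq(3) order_trans)
  then show ?thesis by blast
qed

end
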